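(* Let $p\geq 1$ and let $\varphi:(0,\pi/2)\to(0,\infty)$ be a continuous function such that $\varphi(\omega)/\tan^{p}(\omega)\to 0$ as $\omega\to\frac{\pi}{2}^{-}$. Then $$\limsup_{\omega\to\frac{\pi}{2}^{-}}\ \sup_{0\neq v\in\ell^{p}(\mathbb{Z})}\frac{1}{\varphi(\omega)\|v\|^{p}_{\ell^{p}}}\sum_{\substack{\lambda\in\sigma_{\mathrm d}(J)\\ 2-\operatorname{Re}\lambda<\tan(\omega)|\operatorname{Im}\lambda|}}|\lambda-2|^{p-1/2}=\infty.$$
   Context: Given bounded complex sequences $\{a_n\}_{n\in\mathbb{Z}},\{b_n\}_{n\in\mathbb{Z}},\{c_n\}_{n\in\mathbb{Z}}$, the Jacobi operator $J$ is the bounded operator in $\ell^2(\mathbb{Z})$ given by $(Ju)_n=a_{n-1}u_{n-1}+b_nu_n+c_nu_{n+1}$, $n\in\mathbb{Z}$. Associated with $J$ is the sequence $v=\{v_n\}_{n\in\mathbb{Z}}$, $$v_n:=\max\{|a_{n-1}-1|,|a_n-1|,|b_n|,|c_{n-1}-1|,|c_n-1|\}.$$ If $v_n\to0$ as $|n|\to\infty$, then the essential spectrum of $J$ is $[-2,2]$; $\sigma_{\mathrm d}(J)\subset\mathbb{C}\setminus[-2,2]$ denotes the discrete spectrum (isolated eigenvalues of finite algebraic multiplicity). In sums over $\sigma_{\mathrm d}(J)$ each eigenvalue is repeated according to its algebraic multiplicity. The supremum over $0\neq v\in\ell^p(\mathbb{Z})$ means the supremum over all Jacobi operators $J$ whose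 associated sequence $v$ is non-zero and belongs to $\ell^p(\mathbb{Z})$. *)

theory Defs
  imports "HOL-Analysis.Analysis" "HOL-Library.Function_Algebras"
begin

text \<open>
  Operators on the complex sequence space over the integers are functions on all sequences
  \<^typ>\<open>int \<Rightarrow> complex\<close>; only their values on the subset \<open>l2\<close> matter.
\<close>

definition l2 :: "(int \<Rightarrow> complex) set" where
  "l2 = {u. (\<lambda>n. (cmod (u n))\<^sup>2) summable_on UNIV}"

definition l2_norm :: "(int \<Rightarrow> complex) \<Rightarrow> real" where
  "l2_norm u = sqrt (\<Sum>\<^sub>\<infinity>n. (cmod (u n))\<^sup>2)"

definition cscale :: "complex \<Rightarrow> (int \<Rightarrow> complex) \<Rightarrow> int \<Rightarrow> complex" where
  "cscale z u = (\<lambda>n. z * u n)"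

global_interpretation cseq: vector_space cscale
  by unfold_locales (auto simp: cscale_def fun_eq_iff algebra_simps)

definition bounded_operator_l2 :: "((int \<Rightarrow> complex) \<Rightarrow> int \<Rightarrow> complex) \<Rightarrow> bool" where
  "bounded_operator_l2 S \<longleftrightarrow>
     (\<forall>u\<in>l2. S u \<in> l2) \<and>
     (\<forall>u\<in>l2. \<forall>w\<in>l2. S (u + w) = S u + S w) \<and>
     (\<forall>z. \<forall>u\<in>l2. S (cscale z u) = cscale z (S u)) \<and>
     (\<exists>C. \<forall>u\<in>l2. l2_norm (S u) \<le> C * l2_norm u)"

definition shift_op ::
  "((int \<Rightarrow> complex) \<Rightarrow> int \<Rightarrow> complex) \<Rightarrow> complex \<Rightarrow> (int \<Rightarrow> complex) \<Rightarrow> int \<Rightarrow> complex" where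
  "shift_op T z u = T u - cscale z u"

definition resolvent_set_l2 :: "((int \<Rightarrow> complex) \<Rightarrow> int \<Rightarrow> complex) \<Rightarrow> complex set" where
  "resolvent_set_l2 T = {z. \<exists>S. bounded_operator_l2 S \<and>
     (\<forall>u\<in>l2. S (shift_op T z u) = u \<and> shift_op T z (S u) = u)}"

definition spectrum_l2 :: "((int \<Rightarrow> complex) \<Rightarrow> int \<Rightarrow> complex) \<Rightarrow> complex set" where
  "spectrum_l2 T = - resolvent_set_l2 T"

definition eigenvalue_l2 :: "((int \<Rightarrow> complex) \<Rightarrow> int \<Rightarrow> complex) \<Rightarrow> complex \<Rightarrow> bool" where
  "eigenvalue_l2 T z \<longleftrightarrow> (\<exists>u\<in>l2. u \<noteq> 0 \<and> T u = cscale z u)"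

definition root_space :: "((int \<Rightarrow> complex) \<Rightarrow> int \<Rightarrow> complex) \<Rightarrow> complex \<Rightarrow> (int \<Rightarrow> complex) set" where
  "root_space T z = {u\<in>l2. \<exists>k. (shift_op T z ^^ k) u = 0}"

definition finite_alg_mult :: "((int \<Rightarrow> complex) \<Rightarrow> int \<Rightarrow> complex) \<Rightarrow> complex \<Rightarrow> bool" where
  "finite_alg_mult T z \<longleftrightarrow> (\<exists>B. finite B \<and> root_space T z \<subseteq> cseq.span B)"

text \<open>The following is meaningful only under \<^const>\<open>finite_alg_mult\<close>.\<close>

definition alg_mult :: "((int \<Rightarrow> complex) \<Rightarrow> int \<Rightarrow> complex) \<Rightarrow> complex \<Rightarrow> nat" where
  "alg_mult T z = cseq.dim (root_space T z)"

definition discrete_spectrum :: "((int \<Rightarrow> complex) \<Rightarrow> int \<Rightarrow> complex) \<Rightarrow> complex set" where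
  "discrete_spectrum T =
     {z. z isolated_in spectrum_l2 T \<and> eigenvalue_l2 T z \<and> finite_alg_mult T z}"

definition jacobi ::
  "(int \<Rightarrow> complex) \<Rightarrow> (int \<Rightarrow> complex) \<Rightarrow> (int \<Rightarrow> complex) \<Rightarrow> (int \<Rightarrow> complex) \<Rightarrow> int \<Rightarrow> complex" where
  "jacobi a b c u = (\<lambda>n. a (n - 1) * u (n - 1) + b n * u n + c n * u (n + 1))"

definition jacobi_v ::
  "(int \<Rightarrow> complex) \<Rightarrow> (int \<Rightarrow> complex) \<Rightarrow> (int \<Rightarrow> complex) \<Rightarrow> int \<Rightarrow> real" where
  "jacobi_v a b c = (\<lambda>n. Max {cmod (a (n - 1) - 1), cmod (a n - 1), cmod (b n),
                              cmod (c (n - 1) - 1), cmod (c n - 1)})"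

definition lp :: "real \<Rightarrow> (int \<Rightarrow> real) set" where
  "lp p = {v. (\<lambda>n. \<bar>v n\<bar> powr p) summable_on UNIV}"

definition lp_norm :: "real \<Rightarrow> (int \<Rightarrow> real) \<Rightarrow> real" where
  "lp_norm p v = (\<Sum>\<^sub>\<infinity>n. \<bar>v n\<bar> powr p) powr (1 / p)"

definition admissible :: "real \<Rightarrow> ((int \<Rightarrow> complex) \<times> (int \<Rightarrow> complex) \<times> (int \<Rightarrow> complex)) set" where
  "admissible p = {(a, b, c). bounded (range a) \<and> bounded (range b) \<and> bounded (range c) \<and>
                     jacobi_v a b c \<noteq> 0 \<and> jacobi_v a b c \<in> lp p}"

text \<open>
  The sum may be infinite, so it is taken in \<^typ>\<open>ennreal\<close>, where a sum of
  nonnegative terms always exists; the factor \<^const>\<open>alg_mult\<close> accounts for the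
  repetition of eigenvalues.
\<close>

definition eigenvalue_sum ::
  "real \<Rightarrow> real \<Rightarrow> ((int \<Rightarrow> complex) \<Rightarrow> int \<Rightarrow> complex) \<Rightarrow> ennreal" where
  "eigenvalue_sum p \<omega> T =
     (\<Sum>\<^sub>\<infinity>z\<in>{z \<in> discrete_spectrum T. 2 - Re z < tan \<omega> * \<bar>Im z\<bar>}.
        of_nat (alg_mult T z) * ennreal (cmod (z - 2) powr (p - 1 / 2)))"

end

theory Submission
  imports Defs
begin

text \<open>
  Write \<open>\<tau> = tan \<omega>\<close>. It suffices to find, for each \<open>\<omega>\<close>, an operator whose ratio of eigenvalue sum to
  \<open>\<parallel>v\<parallel>\<^sup>p\<close> is at least a constant times \<open>\<tau>\<^sup>p\<close>: by hypothesis \<open>\<tau>\<^sup>p / \<phi> \<omega>\<close> tends to infinity.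

  Let \<open>h = 4 / \<tau>\<close>, put the constant potential \<open>i h\<close> on a block of \<open>N = 2 L\<close> sites, and cut the two
  bonds joining the block to the half lines outside, by setting the off-diagonal entries there to
  \<open>0\<close>; otherwise the operator is free. The cuts change \<open>v\<close> at four sites only, so that
  \<open>\<parallel>v\<parallel>\<^sup>p \<le> 2 L h\<^sup>p + 4 \<le> 4 L h\<^sup>p\<close> once \<open>L\<close> is large for the given \<open>h\<close>. On the other hand the
  block has the explicit eigenvalues \<open>i h + 2 cos (\<pi> k / (N + 1))\<close> for \<open>k = 1, \<dots>, N\<close>. All satisfy
  \<open>2 - Re \<lambda> < 4 = \<tau> |Im \<lambda>|\<close>, and \<open>|\<lambda> - 2| \<ge> 2\<close> for the \<open>L\<close> of them with \<open>k > L\<close>. Hence the sum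
  is at least \<open>L\<close> and the ratio at least \<open>1 / (4 h\<^sup>p) = \<tau>\<^sup>p / (4 \<sqdot> 4\<^sup>p)\<close>.

  It remains to see that these eigenvalues belong to the discrete spectrum. Substituting
  \<open>z = q + 1 / q\<close>, the method of images gives an explicit Green kernel of the decoupled operator for
  every nonreal \<open>z\<close> outside a finite set (\<open>block_green_eq\<close>). It decays exponentially, hence is
  bounded on \<open>l2\<close> by Schur's test (\<open>jacobi_resolventI\<close>), and the eigenvalues are isolated. The root
  spaces have finite dimension because root vectors vanish outside the block
  (\<open>root_space_block_jacobi\<close>).
\<close>

section \<open>Operators with exponentially decaying kernels\<close>

lemma summable_on_power_abs:
  fixes r :: real
  assumes "0 \<le> r" "r < 1"
  shows "(\<lambda>d::int. r ^ nat \<bar>d\<bar>) summable_on UNIV"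
proof -
  have s: "(\<lambda>n::nat. r ^ n) summable_on UNIV"
    by (rule norm_summable_imp_summable_on) (use assms in \<open>auto simp: summable_geometric\<close>)
  have "(\<lambda>d::int. r ^ nat \<bar>d\<bar>) summable_on range int"
    by (subst summable_on_reindex) (use s in \<open>auto simp: o_def\<close>)
  moreover have "(\<lambda>d::int. r ^ nat \<bar>d\<bar>) summable_on range (\<lambda>n. - int n)"
    by (subst summable_on_reindex) (use s in \<open>auto simp: o_def inj_on_def\<close>)
  ultimately have "(\<lambda>d::int. r ^ nat \<bar>d\<bar>) summable_on (range int \<union> range (\<lambda>n. - int n))"
    by (rule summable_on_union)
  moreover have "range int \<union> range (\<lambda>n. - int n) = UNIV"
  proof (intro equalityI subsetI UNIV_I)
    fix d :: int
    have "d = int (nat d) \<or> d = - int (nat (-d))" by linarith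
    then show "d \<in> range int \<union> range (\<lambda>n. - int n)" by blast
  qed
  ultimately show ?thesis by simp
qed

lemma bij_int_shift: "bij (\<lambda>n::int. n + k)" "bij (\<lambda>n::int. n - k)" "bij (\<lambda>n::int. k - n)"
  by (rule bij_betw_byWitness[where f' = "\<lambda>n. n - k"], auto,
      rule bij_betw_byWitness[where f' = "\<lambda>n. n + k"], auto,
      rule bij_betw_byWitness[where f' = "\<lambda>n. k - n"], auto)

text \<open>The Cauchy--Schwarz inequality for a weight: expand the nonnegative sum
  \<open>\<Sum> w (x - s / \<kappa>)\<^sup>2\<close>, where \<open>\<kappa>\<close> is the total weight and \<open>s\<close> the weighted sum of \<open>x\<close>.\<close>

lemma weighted_sum_square_le:
  fixes w x :: "'a \<Rightarrow> real"
  assumes w: "(w has_sum \<kappa>) A" and s: "((\<lambda>i. w i * x i) has_sum s) A"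
    and q: "((\<lambda>i. w i * (x i)\<^sup>2) has_sum q) A"
    and nonneg: "\<And>i. i \<in> A \<Longrightarrow> 0 \<le> w i" and "0 < \<kappa>"
  shows "s\<^sup>2 \<le> \<kappa> * q"
proof -
  define t where "t = s / \<kappa>"
  have "((\<lambda>i. w i * (x i)\<^sup>2 + ((-2 * t) * (w i * x i) + t\<^sup>2 * w i)) has_sum
          (q + ((-2 * t) * s + t\<^sup>2 * \<kappa>))) A"
    by (intro has_sum_add has_sum_cmult_right w s q)
  moreover have "w i * (x i)\<^sup>2 + ((-2 * t) * (w i * x i) + t\<^sup>2 * w i) \<ge> 0" if "i \<in> A" for i
  proof -
    have "w i * (x i)\<^sup>2 + ((-2 * t) * (w i * x i) + t\<^sup>2 * w i) = w i * (x i - t)\<^sup>2"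
      by (simp add: power2_eq_square algebra_simps)
    with nonneg[OF that] show ?thesis by simp
  qed
  ultimately have "0 \<le> q + ((-2 * t) * s + t\<^sup>2 * \<kappa>)"
    by (rule has_sum_nonneg)
  also have "\<dots> = q - s\<^sup>2 / \<kappa>"
    using \<open>0 < \<kappa>\<close> by (simp add: t_def field_simps power2_eq_square)
  finally show ?thesis
    using \<open>0 < \<kappa>\<close> by (simp add: field_simps)
qed

lemma l2_bounded:
  assumes "u \<in> l2"
  shows "cmod (u n) \<le> l2_norm u"
proof -
  have "sum (\<lambda>n. (cmod (u n))\<^sup>2) {n} \<le> (\<Sum>\<^sub>\<infinity>n. (cmod (u n))\<^sup>2)"
    by (rule finite_sum_le_infsum) (use assms in \<open>auto simp: l2_def\<close>)
  then show ?thesis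
    by (simp add: l2_norm_def real_le_rsqrt)
qed

lemma l2_finite_support:
  assumes "finite A" "\<And>n. n \<notin> A \<Longrightarrow> u n = 0"
  shows "u \<in> l2"
proof -
  have "(\<lambda>n. (cmod (u n))\<^sup>2) summable_on A" using assms(1) by (rule summable_on_finite)
  also have "?this \<longleftrightarrow> (\<lambda>n. (cmod (u n))\<^sup>2) summable_on UNIV"
    by (rule summable_on_cong_neutral) (use assms in auto)
  finally show ?thesis by (simp add: l2_def)
qed

lemma l2_dominated:
  assumes "g summable_on UNIV" "\<And>n. (cmod (u n))\<^sup>2 \<le> g n"
  shows "u \<in> l2"
proof -
  have "(\<lambda>n. norm ((cmod (u n))\<^sup>2)) summable_on UNIV"
    by (rule Infinite_Sum.abs_summable_on_comparison_test[where g = g])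
       (use assms iffD1[OF summable_on_iff_abs_summable_on_real assms(1)] in
         \<open>auto intro: order_trans[OF _ abs_ge_self]\<close>)
  then show ?thesis by (simp add: l2_def)
qed

lemma l2_cscale: "u \<in> l2 \<Longrightarrow> cscale z u \<in> l2"
  by (auto simp: l2_def cscale_def norm_mult power_mult_distrib intro: summable_on_cmult_right)

lemma l2_add:
  assumes "u \<in> l2" "w \<in> l2"
  shows "u + w \<in> l2"
proof (rule l2_dominated)
  show "(\<lambda>n. 2 * ((cmod (u n))\<^sup>2 + (cmod (w n))\<^sup>2)) summable_on UNIV"
    using assms by (intro summable_on_cmult_right summable_on_add) (auto simp: l2_def)
  fix n
  have "(cmod (u n + w n))\<^sup>2 \<le> (cmod (u n) + cmod (w n))\<^sup>2"
    by (intro power_mono norm_triangle_ineq) auto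
  also have "\<dots> \<le> 2 * ((cmod (u n))\<^sup>2 + (cmod (w n))\<^sup>2)"
    using zero_le_power2[of "cmod (u n) - cmod (w n)"] by (simp add: power2_eq_square algebra_simps)
  finally show "(cmod ((u + w) n))\<^sup>2 \<le> 2 * ((cmod (u n))\<^sup>2 + (cmod (w n))\<^sup>2)" by simp
qed

lemma l2_bounded_mult_shift:
  assumes u: "u \<in> l2" and B: "\<And>n. cmod (a n) \<le> B"
  shows "(\<lambda>n. a n * u (n + k)) \<in> l2"
proof (rule l2_dominated)
  have "(\<lambda>n. (cmod (u (n + k)))\<^sup>2) summable_on UNIV"
    using summable_on_reindex_bij_betw[OF bij_int_shift(1)[of k], of "\<lambda>n. (cmod (u n))\<^sup>2"] u
    by (simp add: l2_def)
  then show "(\<lambda>n. B\<^sup>2 * (cmod (u (n + k)))\<^sup>2) summable_on UNIV"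
    by (rule summable_on_cmult_right)
  fix n
  show "(cmod (a n * u (n + k)))\<^sup>2 \<le> B\<^sup>2 * (cmod (u (n + k)))\<^sup>2"
    unfolding norm_mult power_mult_distrib by (intro mult_right_mono power_mono B) auto
qed

lemma jacobi_l2:
  assumes "\<And>n. cmod (a n) \<le> B" "\<And>n. cmod (b n) \<le> B" "\<And>n. cmod (c n) \<le> B" "u \<in> l2"
  shows "jacobi a b c u \<in> l2"
proof -
  have "(\<lambda>n. a (n - 1) * u (n + (-1))) + (\<lambda>n. b n * u (n + 0)) + (\<lambda>n. c n * u (n + 1)) \<in> l2"
    by (intro l2_add l2_bounded_mult_shift[where B = B] assms)
  then show ?thesis by (simp add: jacobi_def plus_fun_def)
qed

lemma shift_op_jacobi_l2:
  assumes "\<And>n. cmod (a n) \<le> B" "\<And>n. cmod (b n) \<le> B" "\<And>n. cmod (c n) \<le> B" "u \<in> l2"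
  shows "shift_op (jacobi a b c) z u \<in> l2"
proof -
  have "jacobi a b c u + cscale (- z) u \<in> l2"
    by (intro l2_add l2_cscale jacobi_l2[where B = B] assms)
  also have "jacobi a b c u + cscale (- z) u = shift_op (jacobi a b c) z u"
    by (auto simp: shift_op_def cscale_def)
  finally show ?thesis .
qed

text \<open>A kernel acts on sequences as an infinite matrix.\<close>

definition kernel_op :: "(int \<Rightarrow> int \<Rightarrow> complex) \<Rightarrow> (int \<Rightarrow> complex) \<Rightarrow> int \<Rightarrow> complex" where
  "kernel_op G u = (\<lambda>m. \<Sum>\<^sub>\<infinity>n. G m n * u n)"

lemma kernel_summable:
  fixes G :: "int \<Rightarrow> int \<Rightarrow> complex"
  assumes "0 \<le> r" "r < 1" and G: "\<And>m n. cmod (G m n) \<le> C * r ^ nat \<bar>m - n\<bar>"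
    and w: "\<And>n. cmod (w n) \<le> B"
  shows "(\<lambda>n. norm (G m n * w n)) summable_on UNIV"
proof -
  have "(\<lambda>n. r ^ nat \<bar>m - n\<bar>) summable_on UNIV"
    using summable_on_reindex_bij_betw[OF bij_int_shift(3)[of m], of "\<lambda>d. r ^ nat \<bar>d\<bar>"]
      summable_on_power_abs[OF assms(1,2)] by simp
  then have "(\<lambda>n. (C * B) * r ^ nat \<bar>m - n\<bar>) summable_on UNIV"
    by (rule summable_on_cmult_right)
  then have "(\<lambda>n. norm ((C * B) * r ^ nat \<bar>m - n\<bar>)) summable_on UNIV"
    using summable_on_iff_abs_summable_on_real by fast
  then show ?thesis
  proof (rule Infinite_Sum.abs_summable_on_comparison_test)
    fix n
    have "cmod (G m n * w n) \<le> (C * r ^ nat \<bar>m - n\<bar>) * B"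
      unfolding norm_mult by (intro mult_mono G w order_trans[OF norm_ge_zero G]) auto
    then show "cmod (G m n * w n) \<le> norm ((C * B) * r ^ nat \<bar>m - n\<bar>)" by (simp add: mult_ac)
  qed
qed

text \<open>A form of Schur's test: the row and column sums of the majorant are bounded by \<open>\<kappa>\<close>.\<close>

lemma kernel_op_l2_bound:
  fixes G :: "int \<Rightarrow> int \<Rightarrow> complex"
  assumes r: "0 \<le> r" "r < 1" and G: "\<And>m n. cmod (G m n) \<le> C * r ^ nat \<bar>m - n\<bar>"
  obtains \<kappa> where "\<kappa> > 0"
    "\<And>u. u \<in> l2 \<Longrightarrow> kernel_op G u \<in> l2 \<and> l2_norm (kernel_op G u) \<le> \<kappa> * l2_norm u"
proof -
  define D where "D = \<bar>C\<bar> + 1"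
  define K where "K = (\<lambda>d. D * r ^ nat \<bar>d\<bar>)"
  have D: "D > 0" by (simp add: D_def)
  have GK: "cmod (G m n) \<le> K (m - n)" for m n
    unfolding K_def by (rule order_trans[OF G]) (use r in \<open>auto simp: D_def intro!: mult_right_mono\<close>)
  have Ksym: "K (m - n) = K (n - m)" for m n
    by (simp add: K_def abs_minus_commute)
  have K0: "K d \<ge> 0" for d using r D by (simp add: K_def)
  have KD: "K d \<le> D" for d using r D by (simp add: K_def power_le_one)
  define \<kappa> where "\<kappa> = infsum K UNIV"
  have K: "(K has_sum \<kappa>) UNIV"
    unfolding \<kappa>_def K_def by (intro has_sum_infsum summable_on_cmult_right summable_on_power_abs r)
  have "sum K {0} \<le> \<kappa>"
    by (rule finite_sum_le_has_sum[OF K]) (auto simp: K0)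
  then have \<kappa>: "\<kappa> > 0" using D by (simp add: K_def)
  have Km: "((\<lambda>n. K (m - n)) has_sum \<kappa>) UNIV" for m
    using has_sum_reindex_bij_betw[OF bij_int_shift(3)[of m], of K] K by simp
  have main: "kernel_op G u \<in> l2 \<and> l2_norm (kernel_op G u) \<le> \<kappa> * l2_norm u" if u: "u \<in> l2" for u
  proof -
    define x where "x = (\<lambda>n. cmod (u n))"
    define E where "E = (\<Sum>\<^sub>\<infinity>n. (x n)\<^sup>2)"
    have E: "((\<lambda>n. (x n)\<^sup>2) has_sum E) UNIV"
      unfolding E_def by (rule has_sum_infsum) (use u in \<open>simp add: l2_def x_def\<close>)
    have E0: "E \<ge> 0" by (rule has_sum_nonneg[OF E]) auto
    have s1: "(\<lambda>n. K (m - n) * x n) summable_on UNIV" for m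
    proof -
      have "(\<lambda>n. norm (complex_of_real (K (m - n)) * u n)) summable_on UNIV"
        by (rule kernel_summable[OF r, where C = D and B = "l2_norm u"])
           (use D r l2_bounded[OF u] in \<open>auto simp: K_def norm_mult norm_power\<close>)
      then show ?thesis by (simp add: norm_mult x_def K0)
    qed
    have s2: "(\<lambda>n. K (m - n) * (x n)\<^sup>2) summable_on UNIV" for m
    proof -
      have "(\<lambda>n. norm (D * (x n)\<^sup>2)) summable_on UNIV"
        using summable_on_cmult_right[of "\<lambda>n. (x n)\<^sup>2" UNIV D] E D
        by (auto simp: summable_on_def)
      then have "(\<lambda>n. norm (K (m - n) * (x n)\<^sup>2)) summable_on UNIV"
        by (rule Infinite_Sum.abs_summable_on_comparison_test)
           (use D K0 KD in \<open>auto simp: abs_mult intro!: mult_right_mono\<close>)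
      then show ?thesis using K0 by simp
    qed
    define q where "q m = (\<Sum>\<^sub>\<infinity>n. K (m - n) * (x n)\<^sup>2)" for m
    have q: "((\<lambda>n. K (m - n) * (x n)\<^sup>2) has_sum q m) UNIV" for m
      unfolding q_def by (rule has_sum_infsum[OF s2])
    have point: "(cmod (kernel_op G u m))\<^sup>2 \<le> \<kappa> * q m" for m
    proof -
      define s where "s = (\<Sum>\<^sub>\<infinity>n. K (m - n) * x n)"
      have abs: "(\<lambda>n. norm (G m n * u n)) summable_on UNIV"
        by (rule kernel_summable[OF r G l2_bounded[OF u]])
      have "cmod (kernel_op G u m) \<le> (\<Sum>\<^sub>\<infinity>n. cmod (G m n * u n))"
        unfolding kernel_op_def by (rule norm_infsum_bound[OF abs])
      also have "\<dots> \<le> s"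
        unfolding s_def
        by (rule infsum_mono[OF abs s1]) (auto simp: norm_mult x_def intro!: mult_right_mono GK)
      finally have "(cmod (kernel_op G u m))\<^sup>2 \<le> s\<^sup>2" by (intro power_mono) auto
      also have "s\<^sup>2 \<le> \<kappa> * q m"
        by (rule weighted_sum_square_le[OF Km _ q]) (use K0 \<kappa> s1 in \<open>auto simp: s_def intro!: has_sum_infsum\<close>)
      finally show ?thesis .
    qed
    have fin: "(\<Sum>m\<in>F. (cmod (kernel_op G u m))\<^sup>2) \<le> \<kappa>\<^sup>2 * E" if F: "finite F" for F
    proof -
      have "((\<lambda>n. \<Sum>m\<in>F. K (m - n) * (x n)\<^sup>2) has_sum (\<Sum>m\<in>F. q m)) UNIV"
        using F by induction (auto intro!: has_sum_add q)
      moreover have "((\<lambda>n. \<kappa> * (x n)\<^sup>2) has_sum \<kappa> * E) UNIV"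
        by (rule has_sum_cmult_right[OF E])
      ultimately have "(\<Sum>m\<in>F. q m) \<le> \<kappa> * E"
      proof (rule has_sum_mono)
        fix n
        have "(\<Sum>m\<in>F. K (m - n)) \<le> \<kappa>"
          unfolding Ksym[of _ n] by (rule finite_sum_le_has_sum[OF Km F]) (auto simp: K0)
        then show "(\<Sum>m\<in>F. K (m - n) * (x n)\<^sup>2) \<le> \<kappa> * (x n)\<^sup>2"
          by (simp flip: sum_distrib_right add: mult_right_mono)
      qed
      then have "\<kappa> * (\<Sum>m\<in>F. q m) \<le> \<kappa> * (\<kappa> * E)" using \<kappa> by simp
      moreover have "(\<Sum>m\<in>F. (cmod (kernel_op G u m))\<^sup>2) \<le> \<kappa> * (\<Sum>m\<in>F. q m)"
        unfolding sum_distrib_left by (rule sum_mono) (rule point)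
      ultimately show ?thesis by (simp add: power2_eq_square mult_ac)
    qed
    have l2: "(\<lambda>m. (cmod (kernel_op G u m))\<^sup>2) summable_on UNIV"
      by (rule nonneg_bdd_above_summable_on) (auto intro!: bdd_aboveI[where M = "\<kappa>\<^sup>2 * E"] fin)
    have "(\<Sum>\<^sub>\<infinity>m. (cmod (kernel_op G u m))\<^sup>2) \<le> \<kappa>\<^sup>2 * E"
      by (rule infsum_le_finite_sums[OF l2]) (rule fin)
    then have "l2_norm (kernel_op G u) \<le> sqrt (\<kappa>\<^sup>2 * E)"
      unfolding l2_norm_def by simp
    also have "\<dots> = \<kappa> * l2_norm u"
      using \<kappa> by (simp add: real_sqrt_mult l2_norm_def E_def x_def)
    finally show ?thesis using l2 by (simp add: l2_def)
  qed
  show ?thesis by (rule that[OF \<kappa> main])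
qed

text \<open>A symmetric exponentially decaying kernel whose columns solve \<open>(J - z) G = \<delta>\<close> is the kernel of
  a two-sided inverse of \<open>J - z\<close>: symmetry and summation by parts turn the one equation into the
  other.\<close>

lemma jacobi_resolventI:
  fixes a b :: "int \<Rightarrow> complex" and G :: "int \<Rightarrow> int \<Rightarrow> complex"
  assumes a: "\<And>n. cmod (a n) \<le> B" and b: "\<And>n. cmod (b n) \<le> B"
    and r: "0 \<le> r" "r < 1" and G: "\<And>m n. cmod (G m n) \<le> C * r ^ nat \<bar>m - n\<bar>"
    and sym: "\<And>m n. G m n = G n m"
    and eq: "\<And>m n. a (m - 1) * G (m - 1) n + (b m - z) * G m n + a m * G (m + 1) n
                    = (if m = n then 1 else 0)"
  shows "z \<in> resolvent_set_l2 (jacobi a b a)"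
proof -
  have summ: "(\<lambda>n. G m n * w n) summable_on UNIV" if "\<And>n. cmod (w n) \<le> B'" for m w B'
    by (rule Infinite_Sum.abs_summable_summable, rule kernel_summable[OF r G that])
  have delta: "((\<lambda>n. (if m = n then 1 else 0) * u n) has_sum u m) UNIV"
    for m and u :: "int \<Rightarrow> complex"
    using has_sum_finite_neutralI[of "{m}" UNIV "\<lambda>n. (if m = n then 1 else 0) * u n" "u m"] by simp
  have shift: "shift_op (jacobi a b a) z u n = a (n - 1) * u (n - 1) + (b n - z) * u n + a n * u (n + 1)"
    for u n
    by (simp add: shift_op_def jacobi_def cscale_def algebra_simps)
  have right: "shift_op (jacobi a b a) z (kernel_op G u) = u" if u: "u \<in> l2" for u
  proof
    fix m
    have S: "((\<lambda>n. G m n * u n) has_sum kernel_op G u m) UNIV" for m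
      unfolding kernel_op_def by (rule has_sum_infsum, rule summ, rule l2_bounded[OF u])
    have "((\<lambda>n. a (m - 1) * (G (m - 1) n * u n) + (b m - z) * (G m n * u n)
              + a m * (G (m + 1) n * u n)) has_sum shift_op (jacobi a b a) z (kernel_op G u) m) UNIV"
      unfolding shift by (intro has_sum_add has_sum_cmult_right S)
    also have "(\<lambda>n. a (m - 1) * (G (m - 1) n * u n) + (b m - z) * (G m n * u n)
              + a m * (G (m + 1) n * u n)) = (\<lambda>n. (if m = n then 1 else 0) * u n)"
      by (simp only: eq[symmetric]) (simp add: algebra_simps)
    finally show "shift_op (jacobi a b a) z (kernel_op G u) m = u m"
      using delta by (rule has_sum_unique)
  qed
  have left: "kernel_op G (shift_op (jacobi a b a) z u) = u" if u: "u \<in> l2" for u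
  proof
    fix m
    define L where "L = l2_norm u"
    have L: "cmod (u n) \<le> L" for n unfolding L_def by (rule l2_bounded[OF u])
    define s1 where "s1 = (\<Sum>\<^sub>\<infinity>n. G m n * (a (n - 1) * u (n - 1)))"
    define s2 where "s2 = (\<Sum>\<^sub>\<infinity>n. G m n * ((b n - z) * u n))"
    define s3 where "s3 = (\<Sum>\<^sub>\<infinity>n. G m n * (a n * u (n + 1)))"
    have B0: "B \<ge> 0" using order_trans[OF norm_ge_zero a] .
    have h1: "((\<lambda>n. G m n * (a (n - 1) * u (n - 1))) has_sum s1) UNIV"
      unfolding s1_def
      by (rule has_sum_infsum, rule summ[where B' = "B * L"])
         (auto simp: norm_mult intro!: mult_mono a L B0)
    have h2: "((\<lambda>n. G m n * ((b n - z) * u n)) has_sum s2) UNIV"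
      unfolding s2_def
      by (rule has_sum_infsum, rule summ[where B' = "(B + cmod z) * L"])
         (auto simp: norm_mult B0 intro!: mult_mono L order_trans[OF norm_triangle_ineq4] add_mono b)
    have h3: "((\<lambda>n. G m n * (a n * u (n + 1))) has_sum s3) UNIV"
      unfolding s3_def
      by (rule has_sum_infsum, rule summ[where B' = "B * L"])
         (auto simp: norm_mult intro!: mult_mono a L B0)
    have "((\<lambda>n. G m (n + 1) * (a n * u n)) has_sum s1) UNIV"
      using h1 has_sum_reindex_bij_betw[OF bij_int_shift(1)[of 1],
          of "\<lambda>n. G m n * (a (n - 1) * u (n - 1))"] by simp
    moreover have "((\<lambda>n. G m (n - 1) * (a (n - 1) * u n)) has_sum s3) UNIV"
      using h3 has_sum_reindex_bij_betw[OF bij_int_shift(2)[of 1],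
          of "\<lambda>n. G m n * (a n * u (n + 1))"] by simp
    ultimately have "((\<lambda>n. G m (n + 1) * (a n * u n) + G m n * ((b n - z) * u n)
          + G m (n - 1) * (a (n - 1) * u n)) has_sum (s1 + s2 + s3)) UNIV"
      using h2 by (intro has_sum_add)
    also have "(\<lambda>n. G m (n + 1) * (a n * u n) + G m n * ((b n - z) * u n)
          + G m (n - 1) * (a (n - 1) * u n)) = (\<lambda>n. (if m = n then 1 else 0) * u n)"
    proof
      fix n
      have "(if m = n then 1 else 0) * u n = (if n = m then 1 else 0) * u n" by simp
      then show "G m (n + 1) * (a n * u n) + G m n * ((b n - z) * u n)
          + G m (n - 1) * (a (n - 1) * u n) = (if m = n then 1 else 0) * u n"
        unfolding sym[of m] by (simp only: eq[symmetric]) (simp add: algebra_simps)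
    qed
    finally have "s1 + s2 + s3 = u m"
      using delta by (rule has_sum_unique)
    moreover have "((\<lambda>n. G m n * shift_op (jacobi a b a) z u n) has_sum (s1 + s2 + s3)) UNIV"
      unfolding shift distrib_left by (intro has_sum_add h1 h2 h3)
    ultimately show "kernel_op G (shift_op (jacobi a b a) z u) m = u m"
      unfolding kernel_op_def by (simp add: infsumI)
  qed
  have bdd: "bounded_operator_l2 (kernel_op G)"
  proof -
    obtain \<kappa> where \<kappa>: "\<And>u. u \<in> l2 \<Longrightarrow> kernel_op G u \<in> l2 \<and> l2_norm (kernel_op G u) \<le> \<kappa> * l2_norm u"
      using kernel_op_l2_bound[OF r G] by metis
    have "kernel_op G (u + w) = kernel_op G u + kernel_op G w" if "u \<in> l2" "w \<in> l2" for u w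
      by (rule ext) (simp add: kernel_op_def distrib_left
          infsum_add[OF summ[OF l2_bounded[OF that(1)]] summ[OF l2_bounded[OF that(2)]]])
    moreover have "kernel_op G (cscale y u) = cscale y (kernel_op G u)" for y u
      by (rule ext) (simp add: kernel_op_def cscale_def mult.left_commute infsum_cmult_right')
    ultimately show ?thesis
      unfolding bounded_operator_l2_def using \<kappa> by blast
  qed
  show ?thesis
    unfolding resolvent_set_l2_def using bdd left right by blast
qed

section \<open>Resolvent of the free operator with a decoupled block\<close>

text \<open>If \<open>F\<close> solves the recurrence of the free operator and has the right jump at \<open>0\<close>, then
  \<open>F \<bar>m - n\<bar>\<close> is a Green kernel on all integers; subtracting the mirror image \<open>F (m + n)\<close> imposes
  the Dirichlet condition at \<open>0\<close>.\<close>

definition reflected_kernel :: "(int \<Rightarrow> complex) \<Rightarrow> int \<Rightarrow> int \<Rightarrow> complex" where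
  "reflected_kernel F m n = (F \<bar>m - n\<bar> - F (m + n)) / (F 1 - F (-1))"

lemma reflected_kernel_sym: "reflected_kernel F m n = reflected_kernel F n m"
  by (simp add: reflected_kernel_def abs_minus_commute add.commute)

lemma reflected_kernel_left: "0 \<le> n \<Longrightarrow> reflected_kernel F 0 n = 0"
  by (simp add: reflected_kernel_def)

lemma reflected_kernel_right:
  assumes "\<And>x. F (2 * L - x) = F x" "n \<le> L"
  shows "reflected_kernel F L n = 0"
  using assms(1)[of "L - n"] assms(2) by (simp add: reflected_kernel_def)

lemma reflected_kernel_eq:
  assumes F: "\<And>x. F (x - 1) + F (x + 1) = e * F x" and d: "F 1 \<noteq> F (-1)"
  shows "reflected_kernel F (m - 1) n + reflected_kernel F (m + 1) n
           = e * reflected_kernel F m n + (if m = n then 1 else 0)"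
proof -
  have main: "F \<bar>m - 1 - n\<bar> + F \<bar>m + 1 - n\<bar> = e * F \<bar>m - n\<bar> + (if m = n then F 1 - F (-1) else 0)"
  proof (cases m n rule: linorder_cases)
    case less
    then have "\<bar>m - 1 - n\<bar> = \<bar>m - n\<bar> + 1" "\<bar>m + 1 - n\<bar> = \<bar>m - n\<bar> - 1" by auto
    with less F[of "\<bar>m - n\<bar>"] show ?thesis
      by (simp only: add.commute[of "F (\<bar>m - n\<bar> - 1)"]) simp
  next
    case equal
    with F[of 0] show ?thesis by (simp add: algebra_simps)
  next
    case greater
    then have "\<bar>m - 1 - n\<bar> = \<bar>m - n\<bar> - 1" "\<bar>m + 1 - n\<bar> = \<bar>m - n\<bar> + 1" by auto
    with greater F[of "\<bar>m - n\<bar>"] show ?thesis by (simp only:) simp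
  qed
  have mirror: "F (m - 1 + n) + F (m + 1 + n) = e * F (m + n)"
    using F[of "m + n"] by (simp add: algebra_simps)
  have "reflected_kernel F (m - 1) n + reflected_kernel F (m + 1) n
      = ((F \<bar>m - 1 - n\<bar> + F \<bar>m + 1 - n\<bar>) - (F (m - 1 + n) + F (m + 1 + n))) / (F 1 - F (-1))"
    unfolding reflected_kernel_def by (simp flip: add_divide_distrib)
  also have "\<dots> = (e * (F \<bar>m - n\<bar> - F (m + n)) + (if m = n then F 1 - F (-1) else 0)) / (F 1 - F (-1))"
    unfolding main mirror by (simp add: right_diff_distrib)
  also have "\<dots> = e * reflected_kernel F m n + (if m = n then 1 else 0)"
    using d by (simp add: reflected_kernel_def add_divide_distrib)
  finally show ?thesis .
qed

lemma powi_recurrence: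
  fixes q :: complex
  assumes "q \<noteq> 0"
  shows "q powi (x - 1) + q powi (x + 1) = (q + 1 / q) * q powi x"
  using assms by (simp add: power_int_diff power_int_add field_simps)

text \<open>For \<open>|q| < 1\<close> and \<open>0 \<le> x \<le> 2 L\<close> this is the \<open>2 L\<close>-periodisation of \<open>q\<close> to the power \<open>\<bar>x\<bar>\<close>, but
  the closed form does not need \<open>|q| < 1\<close>. Besides the recurrence it has the symmetry about \<open>L\<close> that
  gives a second Dirichlet condition there.\<close>

definition periodised_power :: "complex \<Rightarrow> int \<Rightarrow> int \<Rightarrow> complex" where
  "periodised_power q L x = (q powi x + q powi (2 * L - x)) / (1 - q powi (2 * L))"

lemma periodised_power_recurrence:
  assumes "q \<noteq> 0"
  shows "periodised_power q L (x - 1) + periodised_power q L (x + 1)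
           = (q + 1 / q) * periodised_power q L x"
proof -
  define y where "y = 2 * L - x"
  have "2 * L - (x - 1) = y + 1" "2 * L - (x + 1) = y - 1" by (simp_all add: y_def)
  then have "periodised_power q L (x - 1) + periodised_power q L (x + 1)
      = ((q powi (x - 1) + q powi (x + 1)) + (q powi (y - 1) + q powi (y + 1))) / (1 - q powi (2 * L))"
    by (simp only: periodised_power_def flip: add_divide_distrib) (simp add: add_ac)
  also have "\<dots> = (q + 1 / q) * periodised_power q L x"
    unfolding powi_recurrence[OF assms] periodised_power_def y_def
    by (simp only: distrib_left times_divide_eq_right)
  finally show ?thesis .
qed

lemma periodised_power_sym: "periodised_power q L (2 * L - x) = periodised_power q L x"
  by (simp add: periodised_power_def add.commute)

lemma periodised_power_jump:
  assumes "q \<noteq> 0" "q powi (2 * L) \<noteq> 1"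
  shows "periodised_power q L 1 - periodised_power q L (-1) = q - 1 / q"
proof -
  have "q powi (2 * L - 1) = q powi (2 * L) / q" "q powi (2 * L + 1) = q powi (2 * L) * q"
    using assms(1) by (simp_all add: power_int_diff power_int_add)
  with assms show ?thesis
    by (simp add: periodised_power_def power_int_minus divide_simps) (simp add: algebra_simps)
qed

text \<open>The couplings are \<open>1\<close> except between \<open>0\<close> and \<open>1\<close> and between \<open>N\<close> and \<open>N + 1\<close>, where they
  vanish; the potential is constant on the block \<open>1..N\<close> and vanishes outside.\<close>

definition cut_coupling :: "int \<Rightarrow> int \<Rightarrow> complex" where
  "cut_coupling N n = (if n = 0 \<or> n = N then 0 else 1)"

definition block_potential :: "complex \<Rightarrow> int \<Rightarrow> int \<Rightarrow> complex" where
  "block_potential \<beta> N n = (if 1 \<le> n \<and> n \<le> N then \<beta> else 0)"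

definition block_jacobi :: "complex \<Rightarrow> int \<Rightarrow> (int \<Rightarrow> complex) \<Rightarrow> int \<Rightarrow> complex" where
  "block_jacobi \<beta> N = jacobi (cut_coupling N) (block_potential \<beta> N) (cut_coupling N)"

text \<open>Green kernel of the decoupled operator at \<open>z\<close>, where \<open>q + 1 / q = z\<close> on the two half lines and
  \<open>s + 1 / s = z - \<beta>\<close> on the block. Each half line is moved to \<open>1, 2, \<dots>\<close> by a shift or a reflection.\<close>

definition block_green :: "complex \<Rightarrow> complex \<Rightarrow> int \<Rightarrow> int \<Rightarrow> int \<Rightarrow> complex" where
  "block_green q s N m n =
     (if 1 \<le> m \<and> m \<le> N \<and> 1 \<le> n \<and> n \<le> N then reflected_kernel (periodised_power s (N + 1)) m n
      else if N < m \<and> N < n then reflected_kernel (power_int q) (m - N) (n - N)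
      else if m \<le> 0 \<and> n \<le> 0 then reflected_kernel (power_int q) (1 - m) (1 - n)
      else 0)"

lemma block_green_sym: "block_green q s N m n = block_green q s N n m"
  by (auto simp: block_green_def intro: reflected_kernel_sym)

lemma block_green_eq:
  assumes N: "1 \<le> N" and q: "q \<noteq> 0" "q + 1 / q = z" "q \<noteq> 1 / q"
    and s: "s \<noteq> 0" "s + 1 / s = z - \<beta>" "s powi (2 * (N + 1)) \<noteq> 1"
  shows "cut_coupling N (m - 1) * block_green q s N (m - 1) n
           + (block_potential \<beta> N m - z) * block_green q s N m n
           + cut_coupling N m * block_green q s N (m + 1) n = (if m = n then 1 else 0)"
proof -
  have s2: "s \<noteq> 1 / s"
  proof
    assume "s = 1 / s"
    then have "s powi 2 = 1" using s(1) by (simp add: power2_eq_square field_simps)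
    then have "s powi (2 * (N + 1)) = 1" by (subst power_int_mult) simp
    with s(3) show False by simp
  qed
  let ?P = "reflected_kernel (periodised_power s (N + 1))"
  let ?Q = "reflected_kernel (power_int q)"
  have P: "?P (k - 1) n + ?P (k + 1) n = (z - \<beta>) * ?P k n + (if k = n then 1 else 0)" for k n
    unfolding s(2)[symmetric]
    by (rule reflected_kernel_eq[OF periodised_power_recurrence[OF s(1)]])
       (use periodised_power_jump[OF s(1,3)] s2 in auto)
  have Q: "?Q (k - 1) n + ?Q (k + 1) n = z * ?Q k n + (if k = n then 1 else 0)" for k n
    unfolding q(2)[symmetric]
    by (rule reflected_kernel_eq[OF powi_recurrence[OF q(1)]])
       (use q(3) in \<open>simp add: power_int_minus inverse_eq_divide\<close>)
  have PR: "?P (N + 1) n = 0" if "n \<le> N + 1" for n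
    by (rule reflected_kernel_right[where F = "periodised_power s (N + 1)", OF periodised_power_sym that])
  consider (block) "1 \<le> m" "m \<le> N" "1 \<le> n" "n \<le> N" | (right) "N < m" "N < n"
    | (left) "m \<le> 0" "n \<le> 0"
    | (off) "m \<noteq> n" "(1 \<le> m \<and> m \<le> N) \<noteq> (1 \<le> n \<and> n \<le> N) \<or> (N < m) \<noteq> (N < n)"
    using N by linarith
  then show ?thesis
  proof cases
    case block
    have "cut_coupling N (m - 1) * block_green q s N (m - 1) n = ?P (m - 1) n"
      using block by (auto simp: block_green_def cut_coupling_def reflected_kernel_left)
    moreover have "cut_coupling N m * block_green q s N (m + 1) n = ?P (m + 1) n"
      using block PR[of n] by (cases "m = N") (auto simp: block_green_def cut_coupling_def)
    moreover have "block_green q s N m n = ?P m n"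
      using block by (auto simp: block_green_def)
    ultimately show ?thesis
      using block P[of m n] by (simp add: block_potential_def algebra_simps)
  next
    case right
    have "cut_coupling N (m - 1) * block_green q s N (m - 1) n = ?Q (m - N - 1) (n - N)"
      using right N by (cases "m = N + 1") (auto simp: block_green_def cut_coupling_def reflected_kernel_left algebra_simps)
    moreover have "cut_coupling N m * block_green q s N (m + 1) n = ?Q (m - N + 1) (n - N)"
      using right N by (auto simp: block_green_def cut_coupling_def algebra_simps)
    moreover have "block_green q s N m n = ?Q (m - N) (n - N)"
      using right by (auto simp: block_green_def)
    ultimately show ?thesis
      using right Q[of "m - N" "n - N"] by (simp add: block_potential_def algebra_simps)
  next
    case left
    have "cut_coupling N (m - 1) * block_green q s N (m - 1) n = ?Q (1 - m + 1) (1 - n)"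
      using left N by (auto simp: block_green_def cut_coupling_def algebra_simps)
    moreover have "cut_coupling N m * block_green q s N (m + 1) n = ?Q (1 - m - 1) (1 - n)"
      using left N by (cases "m = 0") (auto simp: block_green_def cut_coupling_def reflected_kernel_left algebra_simps)
    moreover have "block_green q s N m n = ?Q (1 - m) (1 - n)"
      using left N by (auto simp: block_green_def)
    ultimately show ?thesis
      using left Q[of "1 - m" "1 - n"] by (simp add: block_potential_def algebra_simps)
  next
    case off
    have "block_green q s N m n = 0"
      using off N by (auto simp: block_green_def)
    moreover have "cut_coupling N (m - 1) * block_green q s N (m - 1) n = 0"
      using off N by (auto simp: block_green_def cut_coupling_def)
    moreover have "cut_coupling N m * block_green q s N (m + 1) n = 0"
      using off N by (auto simp: block_green_def cut_coupling_def)
    ultimately show ?thesis using off(1) by (simp only: mult_zero_right add_0_right if_False)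
  qed
qed

lemma reflected_power_bound:
  assumes q: "q \<noteq> 0" "cmod q < 1" and m: "1 \<le> m" "1 \<le> n"
  shows "cmod (reflected_kernel (power_int q) m n)
           \<le> (2 / cmod (q - 1 / q)) * cmod q ^ nat \<bar>m - n\<bar>"
proof -
  have "cmod (q powi \<bar>m - n\<bar> - q powi (m + n)) \<le> cmod q ^ nat \<bar>m - n\<bar> + cmod q ^ nat (m + n)"
    using m by (intro order_trans[OF norm_triangle_ineq4]) (simp add: power_int_def norm_power)
  also have "cmod q ^ nat (m + n) \<le> cmod q ^ nat \<bar>m - n\<bar>"
    using q m by (intro power_decreasing) auto
  finally have "cmod (q powi \<bar>m - n\<bar> - q powi (m + n)) \<le> 2 * cmod q ^ nat \<bar>m - n\<bar>" by simp
  then show ?thesis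
    by (simp add: reflected_kernel_def norm_divide power_int_minus inverse_eq_divide divide_right_mono)
qed

lemma block_green_bound:
  assumes q: "q \<noteq> 0" "cmod q < 1"
  obtains C where "\<And>m n. cmod (block_green q s N m n) \<le> C * cmod q ^ nat \<bar>m - n\<bar>"
proof -
  let ?P = "reflected_kernel (periodised_power s (N + 1))"
  define S where "S = (\<Sum>(m, n)\<in>{1..N} \<times> {1..N}. cmod (?P m n))"
  have S: "cmod (?P m n) \<le> S" if "1 \<le> m" "m \<le> N" "1 \<le> n" "n \<le> N" for m n
    using member_le_sum[of "(m, n)" "{1..N} \<times> {1..N}" "\<lambda>(m, n). cmod (?P m n)"] that
    by (auto simp: S_def)
  have S0: "S \<ge> 0" unfolding S_def by (rule sum_nonneg) auto
  define C where "C = max (2 / cmod (q - 1 / q)) (S / cmod q ^ nat N)"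
  have C0: "C \<ge> 0" by (simp add: C_def le_max_iff_disj)
  have "cmod (block_green q s N m n) \<le> C * cmod q ^ nat \<bar>m - n\<bar>" for m n
  proof -
    consider (block) "1 \<le> m" "m \<le> N" "1 \<le> n" "n \<le> N"
      | (right) "\<not> (1 \<le> m \<and> m \<le> N \<and> 1 \<le> n \<and> n \<le> N)" "N < m" "N < n"
      | (left) "\<not> (1 \<le> m \<and> m \<le> N \<and> 1 \<le> n \<and> n \<le> N)" "\<not> (N < m \<and> N < n)" "m \<le> 0" "n \<le> 0"
      | (off) "\<not> (1 \<le> m \<and> m \<le> N \<and> 1 \<le> n \<and> n \<le> N)" "\<not> (N < m \<and> N < n)" "\<not> (m \<le> 0 \<and> n \<le> 0)"
      by blast
    then show ?thesis
    proof cases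
      case block
      have "cmod (?P m n) \<le> S" by (rule S[OF block])
      also have "\<dots> = S / cmod q ^ nat N * cmod q ^ nat N" using q by simp
      also have "\<dots> \<le> C * cmod q ^ nat \<bar>m - n\<bar>"
        using block q C0 by (intro mult_mono power_decreasing) (auto simp: C_def)
      finally show ?thesis using block by (simp add: block_green_def)
    next
      case right
      then have "cmod (block_green q s N m n) \<le> (2 / cmod (q - 1 / q)) * cmod q ^ nat \<bar>m - n\<bar>"
        using reflected_power_bound[OF q, of "m - N" "n - N"] by (auto simp: block_green_def)
      also have "\<dots> \<le> C * cmod q ^ nat \<bar>m - n\<bar>" by (intro mult_right_mono) (auto simp: C_def)
      finally show ?thesis .
    next
      case left
      then have "cmod (block_green q s N m n) \<le> (2 / cmod (q - 1 / q)) * cmod q ^ nat \<bar>m - n\<bar>"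
        using reflected_power_bound[OF q, of "1 - m" "1 - n"]
        by (auto simp: block_green_def abs_minus_commute)
      also have "\<dots> \<le> C * cmod q ^ nat \<bar>m - n\<bar>" by (intro mult_right_mono) (auto simp: C_def)
      finally show ?thesis .
    next
      case off
      then have "block_green q s N m n = 0" unfolding block_green_def by (simp only: if_False)
      then show ?thesis using C0 by simp
    qed
  qed
  then show ?thesis by (rule that)
qed

lemma joukowski_surj:
  obtains q :: complex where "q \<noteq> 0" "q + 1 / q = z" "cmod q \<le> 1"
proof -
  define t where "t = csqrt (z\<^sup>2 - 4)"
  define q where "q = (z + t) / 2"
  have "q * (z - q) = (z\<^sup>2 - t\<^sup>2) / 4"
    by (simp add: q_def algebra_simps power2_eq_square add_divide_distrib diff_divide_distrib)
  also have "\<dots> = 1" by (simp add: t_def)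
  finally have "q * (z - q) = 1" .
  then have q0: "q \<noteq> 0" by auto
  with \<open>q * (z - q) = 1\<close> have "z - q = 1 / q" by (metis nonzero_mult_div_cancel_left)
  then have q: "q \<noteq> 0" "q + 1 / q = z" using q0 by (simp_all add: diff_eq_eq add.commute)
  show ?thesis
  proof (cases "cmod q \<le> 1")
    case True
    with q show ?thesis by (rule that)
  next
    case False
    then show ?thesis
      using q by (intro that[of "1 / q"]) (simp_all add: norm_divide add.commute)
  qed
qed

lemma joukowski_nonreal:
  assumes "q + 1 / q = z" "cmod q \<le> 1" "z \<notin> \<real>"
  shows "cmod q < 1"
proof (rule ccontr)
  assume "\<not> cmod q < 1"
  with assms(2) have "cmod q = 1" by simp
  then have "q * cnj q = 1" by (simp add: complex_norm_square[symmetric])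
  then have "1 / q = cnj q" by (metis mult_zero_left nonzero_mult_div_cancel_left zero_neq_one)
  then have "z = of_real (2 * Re q)" using assms(1) complex_add_cnj[of q] by simp
  with assms(3) show False by (metis Reals_of_real)
qed

lemma block_jacobi_resolventI:
  assumes N: "1 \<le> N" and z: "z \<notin> \<real>"
    and s: "s \<noteq> 0" "s + 1 / s = z - \<beta>" "s powi (2 * (N + 1)) \<noteq> 1"
  shows "z \<in> resolvent_set_l2 (block_jacobi \<beta> N)"
proof -
  obtain q where q: "q \<noteq> 0" "q + 1 / q = z" "cmod q \<le> 1" by (rule joukowski_surj)
  have q1: "cmod q < 1" using q(2,3) z by (rule joukowski_nonreal)
  have q2: "q \<noteq> 1 / q"
  proof
    assume "q = 1 / q"
    then have "cmod q * cmod q = 1"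
      using q(1) by (simp add: field_simps flip: norm_mult)
    moreover have "cmod q * cmod q < 1"
      using q1 by (metis mult_less_cancel_left2 mult_strict_mono norm_ge_zero mult_1 zero_less_one)
    ultimately show False by simp
  qed
  obtain C where C: "\<And>m n. cmod (block_green q s N m n) \<le> C * cmod q ^ nat \<bar>m - n\<bar>"
    using block_green_bound[OF q(1) q1] by blast
  show ?thesis
    unfolding block_jacobi_def
    by (rule jacobi_resolventI[where G = "block_green q s N" and r = "cmod q" and B = "max 1 (cmod \<beta>)",
          OF _ _ _ q1 C block_green_sym block_green_eq[OF N q(1,2) q2 s]])
       (auto simp: cut_coupling_def block_potential_def)
qed

section \<open>Discrete spectrum of the decoupled operator\<close>

text \<open>These are the eigenvalues of the block (and \<open>\<beta> \<plusminus> 2\<close>); only their finiteness matters.\<close>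

lemma finite_block_exceptional:
  assumes "1 \<le> N"
  shows "finite {\<beta> + (s + 1 / s) | s :: complex. s powi (2 * (N + 1)) = 1}"
proof -
  have "finite {s :: complex. s ^ nat (2 * (N + 1)) = 1}"
    using assms by (intro finite_roots_unity) auto
  moreover have "s powi (2 * (N + 1)) = s ^ nat (2 * (N + 1))" for s :: complex
    using assms by (simp add: power_int_def)
  ultimately have "finite {s :: complex. s powi (2 * (N + 1)) = 1}" by simp
  then have "finite ((\<lambda>s. \<beta> + (s + 1 / s)) ` {s :: complex. s powi (2 * (N + 1)) = 1})"
    by (rule finite_imageI)
  then show ?thesis by (simp add: image_def Collect_conj_eq conj_commute)
qed

lemma block_jacobi_isolated:
  assumes N: "1 \<le> N" and z: "z \<in> spectrum_l2 (block_jacobi \<beta> N)" "z \<notin> \<real>"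
  shows "z isolated_in spectrum_l2 (block_jacobi \<beta> N)"
proof -
  define E where "E = {\<beta> + (s + 1 / s) | s :: complex. s powi (2 * (N + 1)) = 1}"
  define T where "T = - (E - {z}) \<inter> - \<real>"
  have "finite (E - {z})" using finite_block_exceptional[OF N] by (simp add: E_def)
  then have "open T"
    unfolding T_def by (intro open_Int open_Compl finite_imp_closed closed_complex_Reals)
  moreover have "w \<in> resolvent_set_l2 (block_jacobi \<beta> N)" if "w \<in> T" "w \<noteq> z" for w
  proof -
    obtain s where s: "s \<noteq> 0" "s + 1 / s = w - \<beta>" "cmod s \<le> 1" by (rule joukowski_surj)
    have "w = \<beta> + (s + 1 / s)" using s(2) by simp
    moreover have "w \<notin> E" "w \<notin> \<real>" using that by (auto simp: T_def)
    ultimately have "s powi (2 * (N + 1)) \<noteq> 1" unfolding E_def by blast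
    then show ?thesis using block_jacobi_resolventI[OF N \<open>w \<notin> \<real>\<close> s(1,2)] by blast
  qed
  moreover have "z \<in> T" using z(2) by (auto simp: T_def)
  ultimately show ?thesis
    unfolding isolated_in_def using z(1) by (auto simp: spectrum_l2_def)
qed

lemma shift_op_block_jacobi:
  "shift_op (block_jacobi \<beta> N) z u n =
     cut_coupling N (n - 1) * u (n - 1) + (block_potential \<beta> N n - z) * u n
       + cut_coupling N n * u (n + 1)"
  by (simp add: shift_op_def block_jacobi_def jacobi_def cscale_def algebra_simps)

lemma shift_op_block_jacobi_l2:
  "u \<in> l2 \<Longrightarrow> shift_op (block_jacobi \<beta> N) z u \<in> l2"
  unfolding block_jacobi_def
  by (rule shift_op_jacobi_l2[where B = "max 1 (cmod \<beta>)"])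
     (auto simp: cut_coupling_def block_potential_def)

lemma eigenvalue_in_spectrum:
  assumes "eigenvalue_l2 T z" "shift_op T z 0 = 0"
  shows "z \<in> spectrum_l2 T"
proof (rule ccontr)
  assume "z \<notin> spectrum_l2 T"
  then obtain S where S: "\<And>u. u \<in> l2 \<Longrightarrow> S (shift_op T z u) = u"
    by (auto simp: spectrum_l2_def resolvent_set_l2_def)
  obtain u where u: "u \<in> l2" "u \<noteq> 0" "T u = cscale z u"
    using assms(1) by (auto simp: eigenvalue_l2_def)
  have "shift_op T z u = shift_op T z 0" using u assms(2) by (simp add: shift_op_def)
  moreover have "0 \<in> l2" by (rule l2_finite_support[of "{}"]) auto
  ultimately show False using S[OF u(1)] S[of 0] u(2) by simp
qed

text \<open>Outside the block the operator does not depend on \<open>\<beta>\<close>, and the cuts make the exterior part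
  invariant. For \<open>\<beta> = 0\<close> a nonreal \<open>z\<close> is in the resolvent set, so root vectors vanish outside the
  block.\<close>

lemma root_space_block_jacobi:
  assumes N: "1 \<le> N" and z: "z \<notin> \<real>" and u: "u \<in> root_space (block_jacobi \<beta> N) z"
    and n: "\<not> (1 \<le> n \<and> n \<le> N)"
  shows "u n = 0"
proof -
  define Q where "Q = (\<lambda>(u :: int \<Rightarrow> complex) n. if 1 \<le> n \<and> n \<le> N then 0 else u n)"
  have intertwine: "Q (shift_op (block_jacobi \<beta> N) z u) = shift_op (block_jacobi 0 N) z (Q u)" for u
  proof
    fix n :: int
    consider "n < 0" | "n = 0" | "1 \<le> n" "n \<le> N" | "n = N + 1" | "n > N + 1"
      using N by linarith
    then show "Q (shift_op (block_jacobi \<beta> N) z u) n = shift_op (block_jacobi 0 N) z (Q u) n"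
      using N by cases (auto simp: Q_def shift_op_block_jacobi cut_coupling_def block_potential_def)
  qed
  obtain k where k: "(shift_op (block_jacobi \<beta> N) z ^^ k) u = 0" and ul2: "u \<in> l2"
    using u by (auto simp: root_space_def)
  have "Q ((shift_op (block_jacobi \<beta> N) z ^^ k) u) = (shift_op (block_jacobi 0 N) z ^^ k) (Q u)" for k
    by (induction k) (simp_all add: intertwine)
  then have iter: "(shift_op (block_jacobi 0 N) z ^^ k) (Q u) = 0"
    unfolding k by (metis (no_types, lifting) Q_def ext k zero_fun_apply)
  have Qu: "Q u \<in> l2"
    by (rule l2_dominated[where g = "\<lambda>n. (cmod (u n))\<^sup>2"]) (use ul2 in \<open>auto simp: l2_def Q_def\<close>)
  obtain s where s: "s \<noteq> 0" "s + 1 / s = z - 0" "cmod s \<le> 1"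
    using joukowski_surj[of z] by auto
  have s1: "cmod s < 1" using joukowski_nonreal[of s z] s z by simp
  have "cmod (s powi (2 * (N + 1))) < 1"
    using s1 N by (simp add: power_int_def norm_power power_less_one_iff)
  then have "s powi (2 * (N + 1)) \<noteq> 1" by auto
  then have "z \<in> resolvent_set_l2 (block_jacobi 0 N)"
    using block_jacobi_resolventI[OF N z s(1,2)] by blast
  then obtain S where S: "\<And>w. w \<in> l2 \<Longrightarrow> S (shift_op (block_jacobi 0 N) z w) = w"
    by (auto simp: resolvent_set_l2_def)
  have zero: "shift_op (block_jacobi 0 N) z 0 = 0"
    by (auto simp: shift_op_block_jacobi)
  have l20: "0 \<in> l2" by (rule l2_finite_support[of "{}"]) auto
  have "w = 0" if "w \<in> l2" "(shift_op (block_jacobi 0 N) z ^^ k) w = 0" for w k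
    using that
  proof (induction k arbitrary: w)
    case (Suc k)
    have "shift_op (block_jacobi 0 N) z w = 0"
      by (rule Suc.IH) (use Suc.prems in \<open>auto simp: shift_op_block_jacobi_l2 funpow_swap1\<close>)
    then show ?case using S[OF Suc.prems(1)] S[OF l20] zero by simp
  qed simp
  from this[OF Qu iter] have "Q u n = 0" by simp
  with n show ?thesis unfolding Q_def by (simp split: if_splits)
qed

lemma finite_support_in_span:
  assumes "finite A"
  obtains B where "finite B" "{u. \<forall>n. n \<notin> A \<longrightarrow> u n = 0} \<subseteq> cseq.span B"
proof
  define e where "e = (\<lambda>k n :: int. if n = k then 1 else 0 :: complex)"
  show "finite (e ` A)" using assms by simp
  show "{u. \<forall>n. n \<notin> A \<longrightarrow> u n = 0} \<subseteq> cseq.span (e ` A)"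
  proof (intro subsetI)
    fix u :: "int \<Rightarrow> complex" assume "u \<in> {u. \<forall>n. n \<notin> A \<longrightarrow> u n = 0}"
    then have u: "u n = 0" if "n \<notin> A" for n using that by simp
    have "(\<Sum>k\<in>A. cscale (u k) (e k)) \<in> cseq.span (e ` A)"
      by (intro cseq.span_sum cseq.span_scale cseq.span_base imageI)
    moreover have "(\<Sum>k\<in>A. cscale (u k) (e k)) n = (\<Sum>k\<in>A. cscale (u k) (e k) n)" for n
      using assms by induction auto
    then have "(\<Sum>k\<in>A. cscale (u k) (e k)) = u"
      using assms u by (auto simp: cscale_def e_def if_distrib[of "(*) _"] cong: if_cong)
    ultimately show "u \<in> cseq.span (e ` A)" by simp
  qed
qed

lemma finite_alg_mult_block_jacobi:
  assumes "1 \<le> N" "z \<notin> \<real>"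
  shows "finite_alg_mult (block_jacobi \<beta> N) z"
proof -
  obtain B where "finite B" "{u. \<forall>n. n \<notin> {1..N} \<longrightarrow> u n = 0} \<subseteq> cseq.span B"
    by (rule finite_support_in_span[of "{1..N}"]) auto
  moreover have "root_space (block_jacobi \<beta> N) z \<subseteq> {u. \<forall>n. n \<notin> {1..N} \<longrightarrow> u n = 0}"
    using root_space_block_jacobi[OF assms, of _ \<beta>] by auto
  ultimately show ?thesis unfolding finite_alg_mult_def by blast
qed

lemma alg_mult_pos:
  assumes "eigenvalue_l2 T z" "finite_alg_mult T z"
  shows "1 \<le> alg_mult T z"
proof -
  obtain u where u: "u \<in> l2" "u \<noteq> 0" "T u = cscale z u"
    using assms(1) by (auto simp: eigenvalue_l2_def)
  then have "(shift_op T z ^^ 1) u = 0" by (simp add: shift_op_def)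
  with u have ur: "u \<in> root_space T z" unfolding root_space_def by blast
  obtain B where B: "finite B" "root_space T z \<subseteq> cseq.span B"
    using assms(2) by (auto simp: finite_alg_mult_def)
  obtain B' where B': "B' \<subseteq> root_space T z" "cseq.independent B'" "root_space T z \<subseteq> cseq.span B'"
      "card B' = cseq.dim (root_space T z)"
    by (rule cseq.basis_exists)
  have "finite B'"
    using cseq.independent_span_bound[OF B(1) B'(2)] B(2) B'(1) by auto
  moreover have "B' \<noteq> {}" using B'(3) ur u(2) by auto
  ultimately show ?thesis
    using B'(4) by (simp add: alg_mult_def Suc_le_eq card_gt_0_iff flip: B'(4))
qed

text \<open>The eigenvectors are the discrete sine functions on the block.\<close>

lemma block_jacobi_eigenvalue:
  fixes N :: int and k :: nat
  assumes k: "1 \<le> k" "int k \<le> N" and \<theta>: "\<theta> = pi * real k / real_of_int (N + 1)"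
  shows "eigenvalue_l2 (block_jacobi \<beta> N) (\<beta> + complex_of_real (2 * cos \<theta>))"
proof -
  define x where "x = (\<lambda>n::int. if 1 \<le> n \<and> n \<le> N then complex_of_real (sin (\<theta> * n)) else 0)"
  have N: "1 \<le> N" using k by simp
  have end0: "sin (\<theta> * real_of_int (N + 1)) = 0"
  proof -
    have "\<theta> * real_of_int (N + 1) = real k * pi" using N by (simp add: \<theta>)
    then show ?thesis by (simp only: sin_npi)
  qed
  have x1: "cut_coupling N (n - 1) * x (n - 1) = complex_of_real (sin (\<theta> * (n - 1)))"
    if "1 \<le> n" "n \<le> N" for n
    using that by (cases "n = 1") (auto simp: x_def cut_coupling_def)
  have x2: "cut_coupling N n * x (n + 1) = complex_of_real (sin (\<theta> * (n + 1)))"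
    if "1 \<le> n" "n \<le> N" for n
    using that end0 by (cases "n = N") (auto simp: x_def cut_coupling_def)
  have trig: "sin (\<theta> * (y - 1)) + sin (\<theta> * (y + 1)) = 2 * cos \<theta> * sin (\<theta> * y)" for y
    by (simp add: right_diff_distrib distrib_left sin_add sin_diff)
  have "block_jacobi \<beta> N x = cscale (\<beta> + complex_of_real (2 * cos \<theta>)) x"
  proof
    fix n :: int
    show "block_jacobi \<beta> N x n = cscale (\<beta> + complex_of_real (2 * cos \<theta>)) x n"
    proof (cases "1 \<le> n \<and> n \<le> N")
      case True
      have "block_jacobi \<beta> N x n
          = \<beta> * x n + complex_of_real (sin (\<theta> * (n - 1)) + sin (\<theta> * (n + 1)))"
        using True x1[of n] x2[of n] by (simp add: block_jacobi_def jacobi_def block_potential_def)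
      also have "\<dots> = cscale (\<beta> + complex_of_real (2 * cos \<theta>)) x n"
        using True unfolding of_int_diff of_int_add of_int_1 trig
        by (simp add: cscale_def x_def algebra_simps)
      finally show ?thesis .
    next
      case False
      then have "x n = 0" "cut_coupling N (n - 1) * x (n - 1) = 0" "cut_coupling N n * x (n + 1) = 0"
        using N by (auto simp: x_def cut_coupling_def)
      then show ?thesis
        by (simp only: block_jacobi_def jacobi_def cscale_def mult_zero_right add_0_right)
    qed
  qed
  moreover have "x \<in> l2" by (rule l2_finite_support[of "{1..N}"]) (auto simp: x_def)
  moreover have "x 1 \<noteq> 0"
  proof -
    have "0 < \<theta>" using k by (simp add: \<theta>)
    moreover have "pi * real k < pi * real_of_int (N + 1)" using k by simp
    then have "\<theta> < pi" using N by (simp add: \<theta> pos_divide_less_eq)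
    ultimately have "sin \<theta> > 0" by (rule sin_gt_zero)
    then show ?thesis using N by (simp add: x_def)
  qed
  then have "x \<noteq> 0" by auto
  ultimately show ?thesis unfolding eigenvalue_l2_def by blast
qed

lemma block_jacobi_discrete_spectrum:
  assumes N: "1 \<le> N" and z: "z \<notin> \<real>" and ev: "eigenvalue_l2 (block_jacobi \<beta> N) z"
  shows "z \<in> discrete_spectrum (block_jacobi \<beta> N)"
proof -
  have "z \<in> spectrum_l2 (block_jacobi \<beta> N)"
    by (rule eigenvalue_in_spectrum[OF ev]) (auto simp: shift_op_block_jacobi)
  then show ?thesis
    unfolding discrete_spectrum_def
    using block_jacobi_isolated[OF N _ z] finite_alg_mult_block_jacobi[OF N z] ev by blast
qed

section \<open>Comparison of the eigenvalue sum with the norm\<close>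

lemma eigenvalue_sum_block_ge:
  fixes L :: nat
  assumes p: "1 \<le> p" and h: "0 < h" "4 \<le> tan \<omega> * h"
  shows "of_nat L \<le> eigenvalue_sum p \<omega> (block_jacobi (\<i> * of_real h) (2 * int L))"
proof -
  let ?T = "block_jacobi (\<i> * of_real h) (2 * int L)"
  define \<theta> where "\<theta> = (\<lambda>k. pi * real k / real_of_int (2 * int L + 1))"
  define ev where "ev = (\<lambda>k. \<i> * of_real h + complex_of_real (2 * cos (\<theta> k)))"
  define K where "K = {L + 1..2 * L}"
  define A where "A = {z \<in> discrete_spectrum ?T. 2 - Re z < tan \<omega> * \<bar>Im z\<bar>}"
  define f where "f = (\<lambda>z. of_nat (alg_mult ?T z) * ennreal (cmod (z - 2) powr (p - 1 / 2)))"
  have \<theta>: "pi / 2 \<le> \<theta> k" "\<theta> k < pi" if "k \<in> K" for k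
  proof -
    have "pi * (2 * real L + 1) \<le> pi * (2 * real k)" "pi * real k < pi * (2 * real L + 1)"
      using that by (auto simp: K_def)
    then show "pi / 2 \<le> \<theta> k" "\<theta> k < pi" by (simp_all add: \<theta>_def pos_divide_less_eq pos_le_divide_eq)
  qed
  have Im: "Im (ev k) = h" and Re: "Re (ev k) = 2 * cos (\<theta> k)" for k
    by (simp_all add: ev_def)
  have nonreal: "ev k \<notin> \<real>" for k using Im h(1) by (metis complex_is_Real_iff less_irrefl)
  have eig: "eigenvalue_l2 ?T (ev k)" if "k \<in> K" for k
    unfolding ev_def by (rule block_jacobi_eigenvalue) (use that in \<open>auto simp: K_def \<theta>_def\<close>)
  have N: "1 \<le> 2 * int L" if "k \<in> K" for k using that by (auto simp: K_def)
  have inA: "ev k \<in> A" if k: "k \<in> K" for k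
  proof -
    have "cos pi < cos (\<theta> k)"
      by (rule cos_monotone_0_pi) (use \<theta>[OF k] pi_gt_zero in linarith)+
    then have "2 - Re (ev k) < 4" by (simp add: Re)
    also have "\<dots> \<le> tan \<omega> * \<bar>Im (ev k)\<bar>" using h by (simp add: Im)
    finally show ?thesis
      using block_jacobi_discrete_spectrum[OF N[OF k] nonreal eig[OF k]] by (simp add: A_def)
  qed
  have f: "1 \<le> f (ev k)" if k: "k \<in> K" for k
  proof -
    have "cos (\<theta> k) \<le> cos (pi / 2)"
      by (rule cos_monotone_0_pi_le) (use \<theta>[OF k] pi_gt_zero in linarith)+
    then have "1 \<le> \<bar>Re (ev k - 2)\<bar>" by (simp add: Re)
    also have "\<dots> \<le> cmod (ev k - 2)" by (rule abs_Re_le_cmod)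
    finally have "1 \<le> cmod (ev k - 2) powr (p - 1 / 2)" using p by (intro ge_one_powr_ge_zero) auto
    moreover have "1 \<le> alg_mult ?T (ev k)"
      by (rule alg_mult_pos[OF eig[OF k] finite_alg_mult_block_jacobi[OF N[OF k] nonreal]])
    ultimately have "1 * 1 \<le> f (ev k)"
      unfolding f_def by (intro mult_mono) auto
    then show ?thesis by simp
  qed
  have inj: "inj_on ev K"
  proof (rule inj_onI)
    fix j k assume jk: "j \<in> K" "k \<in> K" "ev j = ev k"
    then have "cos (\<theta> j) = cos (\<theta> k)" using Re by (metis mult_left_cancel zero_neq_numeral)
    then have "\<theta> j = \<theta> k"
      by (rule cos_inj_pi[rotated 4]) (use \<theta>[OF jk(1)] \<theta>[OF jk(2)] pi_gt_zero in linarith)+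
    then show "j = k" by (simp add: \<theta>_def field_simps split: if_splits)
  qed
  have "of_nat L = (\<Sum>k\<in>K. 1 :: ennreal)" by (simp add: K_def)
  also have "\<dots> \<le> (\<Sum>k\<in>K. f (ev k))" by (rule sum_mono) (rule f)
  also have "\<dots> = infsum f (ev ` K)"
    using inj by (simp add: sum.reindex K_def)
  also have "\<dots> \<le> infsum f A"
    by (rule infsum_mono_neutral) (use inA in \<open>auto intro: nonneg_summable_on_complete\<close>)
  finally show ?thesis by (simp add: eigenvalue_sum_def A_def f_def)
qed

text \<open>The sequence \<open>v\<close> of the decoupled operator with potential \<open>i h\<close> on the block.\<close>

definition block_v :: "real \<Rightarrow> int \<Rightarrow> int \<Rightarrow> real" where
  "block_v h N = jacobi_v (cut_coupling N) (block_potential (\<i> * of_real h) N) (cut_coupling N)"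

text \<open>The potential contributes \<open>h\<close> on the block, the cuts contribute \<open>1\<close> at the adjacent sites; adding
  the two bounds avoids deciding which is larger at the sites \<open>1\<close> and \<open>N\<close>.\<close>

lemma block_v_powr_le:
  assumes p: "1 \<le> p" and h: "0 < h" and N: "1 \<le> N"
  shows "\<bar>block_v h N n\<bar> powr p
           \<le> (if n \<in> {1..N} then h powr p else 0) + (if n \<in> {0, 1, N, N + 1} then 1 else 0)"
proof -
  let ?S = "{cmod (cut_coupling N (n - 1) - 1), cmod (cut_coupling N n - 1),
    cmod (block_potential (\<i> * of_real h) N n),
    cmod (cut_coupling N (n - 1) - 1), cmod (cut_coupling N n - 1)}"
  have "Max ?S \<in> ?S" by (rule Max_in) auto
  then have "block_v h N n \<in> ?S" by (simp add: block_v_def jacobi_v_def)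
  then show ?thesis
    using h p N by (auto simp: cut_coupling_def block_potential_def norm_mult split: if_splits)
qed

lemma block_v_at_cut: "1 \<le> block_v h N 0"
proof -
  have "cmod (cut_coupling N 0 - 1) \<le> block_v h N 0"
    unfolding block_v_def jacobi_v_def by (rule Max_ge) auto
  then show ?thesis by (simp add: cut_coupling_def)
qed

lemma block_v_summable:
  assumes "1 \<le> p" "0 < h" "1 \<le> N"
  shows "(\<lambda>n. \<bar>block_v h N n\<bar> powr p) summable_on UNIV"
    and "(\<Sum>\<^sub>\<infinity>n. \<bar>block_v h N n\<bar> powr p) \<le> real_of_int N * h powr p + 4"
    and "1 \<le> (\<Sum>\<^sub>\<infinity>n. \<bar>block_v h N n\<bar> powr p)"
proof -
  let ?g = "\<lambda>n. \<bar>block_v h N n\<bar> powr p"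
  have zero: "?g n = 0" if "n \<notin> {0..N + 1}" for n
    using block_v_powr_le[OF assms, of n] that assms(3) powr_ge_zero[of "\<bar>block_v h N n\<bar>" p]
    by (auto split: if_splits)
  have "?g summable_on {0..N + 1}" by (rule summable_on_finite) simp
  also have "?this \<longleftrightarrow> ?g summable_on UNIV"
    by (rule summable_on_cong_neutral) (use zero in auto)
  finally show summ: "?g summable_on UNIV" .
  have "infsum ?g UNIV = infsum ?g {0..N + 1}"
    by (rule infsum_cong_neutral) (use zero in auto)
  also have "\<dots> = (\<Sum>n\<in>{0..N + 1}. ?g n)" by simp
  also have "\<dots> \<le> (\<Sum>n\<in>{0..N + 1}. (if n \<in> {1..N} then h powr p else 0)
                                + (if n \<in> {0, 1, N, N + 1} then 1 else 0))"
    by (rule sum_mono) (rule block_v_powr_le[OF assms])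
  also have "\<dots> = real_of_int N * h powr p + real (card ({0..N + 1} \<inter> {0, 1, N, N + 1}))"
  proof -
    have "(\<Sum>n\<in>{0..N + 1}. if n \<in> {1..N} then h powr p else 0) = (\<Sum>n\<in>{0..N + 1} \<inter> {1..N}. h powr p)"
      by (rule sum.inter_restrict[symmetric]) simp
    also have "{0..N + 1} \<inter> {1..N} = {1..N}" by auto
    finally have "(\<Sum>n\<in>{0..N + 1}. if n \<in> {1..N} then h powr p else 0) = real_of_int N * h powr p"
      using assms(3) by simp
    moreover have "(\<Sum>n\<in>{0..N + 1}. if n \<in> {0, 1, N, N + 1} then 1 else 0 :: real)
        = (\<Sum>n\<in>{0..N + 1} \<inter> {0, 1, N, N + 1}. 1)"
      by (rule sum.inter_restrict[symmetric]) simp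
    ultimately show ?thesis by (simp only: sum.distrib card_eq_sum of_nat_sum of_nat_1)
  qed
  also have "card ({0..N + 1} \<inter> {0, 1, N, N + 1}) \<le> card {0, 1, N, N + 1}"
    by (rule card_mono) auto
  also have "card {0, 1, N, N + 1} \<le> 4"
    by (intro card_insert_le_m1) auto
  finally show "infsum ?g UNIV \<le> real_of_int N * h powr p + 4" by simp
  have "1 \<le> sum ?g {0}"
    using block_v_at_cut[of h N] assms(1) by (simp add: ge_one_powr_ge_zero)
  also have "\<dots> \<le> infsum ?g UNIV" by (rule finite_sum_le_infsum[OF summ]) auto
  finally show "1 \<le> infsum ?g UNIV" .
qed

lemma block_admissible:
  assumes "1 \<le> p" "0 < h" "1 \<le> N"
  shows "(cut_coupling N, block_potential (\<i> * of_real h) N, cut_coupling N) \<in> admissible p"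
proof -
  have "block_v h N \<noteq> 0" using block_v_at_cut[of h N] by (metis not_one_le_zero zero_fun_apply)
  moreover have "bounded (range (cut_coupling N))"
    by (rule boundedI[where B = 1]) (auto simp: cut_coupling_def)
  moreover have "bounded (range (block_potential (\<i> * of_real h) N))"
    by (rule boundedI[where B = h]) (use assms(2) in \<open>auto simp: block_potential_def norm_mult\<close>)
  ultimately show ?thesis
    using block_v_summable(1)[OF assms] by (simp add: admissible_def lp_def block_v_def)
qed

text \<open>With \<open>h = 4 / tan \<omega>\<close> every block eigenvalue satisfies the cone condition; a block so long that
  \<open>L h\<^sup>p \<ge> 2\<close> costs at least as much as the four sites next to the cuts.\<close>

lemma sup_ratio_ge:
  assumes p: "1 \<le> p" and \<omega>: "\<omega> \<in> {0<..<pi/2}" and \<phi>: "0 < \<phi> \<omega>"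
  shows "ennreal (tan \<omega> powr p / (4 * 4 powr p * \<phi> \<omega>))
    \<le> (SUP (a, b, c) \<in> admissible p.
          ennreal (1 / (\<phi> \<omega> * lp_norm p (jacobi_v a b c) powr p))
            * eigenvalue_sum p \<omega> (jacobi a b c))"
proof -
  define h where "h = 4 / tan \<omega>"
  have tan: "0 < tan \<omega>" using \<omega> by (intro tan_gt_zero) auto
  then have h: "0 < h" "4 \<le> tan \<omega> * h" by (simp_all add: h_def)
  obtain L :: nat where L: "2 / h powr p < real L" using reals_Archimedean2 by blast
  have "0 < 2 / h powr p" using h by simp
  then have L0: "0 < L" using L by linarith
  have Lh: "2 \<le> real L * h powr p" using L h by (simp add: field_simps)
  have N: "1 \<le> 2 * int L" using L0 by simp
  define S where "S = (\<Sum>\<^sub>\<infinity>n. \<bar>block_v h (2 * int L) n\<bar> powr p)"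
  have S1: "1 \<le> S" unfolding S_def by (rule block_v_summable(3)[OF p h(1) N])
  have "S \<le> real_of_int (2 * int L) * h powr p + 4"
    unfolding S_def by (rule block_v_summable(2)[OF p h(1) N])
  with Lh have S2: "S \<le> 4 * (real L * h powr p)" by simp
  have norm: "lp_norm p (block_v h (2 * int L)) powr p = S"
    using p S1 by (simp add: lp_norm_def S_def[symmetric] powr_powr)
  have "tan \<omega> powr p / (4 * 4 powr p * \<phi> \<omega>) = real L / (\<phi> \<omega> * (4 * (real L * h powr p)))"
    using tan L0 \<phi> by (simp add: h_def powr_divide field_simps)
  also have "\<dots> \<le> real L / (\<phi> \<omega> * S)"
    using S1 S2 \<phi> L0 h(1) by (intro divide_left_mono mult_left_mono mult_pos_pos) auto
  finally have "ennreal (tan \<omega> powr p / (4 * 4 powr p * \<phi> \<omega>)) \<le> ennreal (1 / (\<phi> \<omega> * S) * real L)"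
    by (simp add: ennreal_leI)
  also have "\<dots> = ennreal (1 / (\<phi> \<omega> * S)) * of_nat L"
    using \<phi> S1 by (subst ennreal_mult) (auto simp: ennreal_of_nat_eq_real_of_nat)
  also have "\<dots> \<le> ennreal (1 / (\<phi> \<omega> * S))
      * eigenvalue_sum p \<omega> (block_jacobi (\<i> * of_real h) (2 * int L))"
    by (intro mult_left_mono eigenvalue_sum_block_ge p h) auto
  also have "\<dots> \<le> (SUP (a, b, c) \<in> admissible p.
          ennreal (1 / (\<phi> \<omega> * lp_norm p (jacobi_v a b c) powr p))
            * eigenvalue_sum p \<omega> (jacobi a b c))"
    by (rule SUP_upper2[OF block_admissible[OF p h(1) N]])
       (simp add: norm block_jacobi_def flip: block_v_def)
  finally show ?thesis .
qed

theorem theorem3p8: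
  fixes p :: real and \<phi> :: "real \<Rightarrow> real"
  assumes "p \<ge> 1"
    and "continuous_on {0<..<pi/2} \<phi>"
    and "\<And>\<omega>. \<omega> \<in> {0<..<pi/2} \<Longrightarrow> \<phi> \<omega> > 0"
    and "((\<lambda>\<omega>. \<phi> \<omega> / tan \<omega> powr p) \<longlongrightarrow> 0) (at_left (pi/2))"
  shows "Limsup (at_left (pi/2))
           (\<lambda>\<omega>. SUP (a, b, c) \<in> admissible p.
              ennreal (1 / (\<phi> \<omega> * lp_norm p (jacobi_v a b c) powr p))
                * eigenvalue_sum p \<omega> (jacobi a b c)) = \<infinity>"
    (is "Limsup _ ?R = \<infinity>")
proof -
  have ge: "ennreal C \<le> Limsup (at_left (pi/2)) ?R" if C: "0 < C" for C
  proof (rule le_Limsup)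
    have "\<forall>\<^sub>F \<omega> in at_left (pi/2). \<phi> \<omega> / tan \<omega> powr p < 1 / (4 * 4 powr p * C)"
      using assms(4) by (rule order_tendstoD) (use C in simp)
    moreover have "\<forall>\<^sub>F \<omega> in at_left (pi/2). \<omega> \<in> {0<..<pi/2}"
      by (rule eventually_at_leftI[of 0]) auto
    ultimately show "\<forall>\<^sub>F \<omega> in at_left (pi/2). ennreal C \<le> ?R \<omega>"
    proof eventually_elim
      case (elim \<omega>)
      have tan: "0 < tan \<omega>" using elim(2) by (intro tan_gt_zero) auto
      have \<phi>: "0 < \<phi> \<omega>" using assms(3) elim(2) by blast
      have "C \<le> tan \<omega> powr p / (4 * 4 powr p * \<phi> \<omega>)"
        using elim(1) C tan \<phi> by (simp add: field_simps)
      then have "ennreal C \<le> ennreal (tan \<omega> powr p / (4 * 4 powr p * \<phi> \<omega>))" by (rule ennreal_leI)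
      also have "\<dots> \<le> ?R \<omega>" by (rule sup_ratio_ge[where \<phi> = \<phi>, OF assms(1) elim(2) \<phi>])
      finally show ?case .
    qed
  qed simp
  show ?thesis
  proof (cases "Limsup (at_left (pi/2)) ?R")
    case (real r)
    with ge[of "r + 1"] show ?thesis by (simp add: ennreal_le_iff)
  next
    case top
    then show ?thesis by (simp add: infinity_ennreal_def)
  qed
qed

end
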